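(* Let $G$ be a graph of girth at least $7$. Then $\mathrm{b}^{\ast}(G)=m^{\ast}(G)+1$.
   Context: All graphs are finite, nonempty, undirected, without loops or multiple edges. The girth of a graph is the length of its shortest cycle (an acyclic graph has girth $\infty$). A proper vertex coloring of $G$ with $k$ colors is a surjective map $c:V(G)\to\{1,\dots,k\}$ with $c(x)\neq c(y)$ for every edge $xy$. In such a coloring, a vertex $v$ is a b-vertex if for every color $j\neq c(v)$ among the $k$ colors, $v$ has a neighbor of color $j$. A vertex $u$ is nice if for every color $j\neq c(u)$, $u$ has a neighbor of color $j$ that is a b-vertex. A $\mathrm{b}^{\ast}$-coloring of $G$ is a proper coloring that has a nice vertex. $\mathrm{b}^{\ast}(G)$ is the maximum number of colors used in a $\mathrm{b}^{\ast}$-coloring of $G$. $m^{\ast}(G)$ is the largest integer $k\ge 0$ such that some vertex of degree at least $k$ in $G$ has at least $k$ neighbors each of degree at least $k$ in $G$. *)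

theory Defs
  imports Main "HOL-Library.Extended_Nat"
begin

text \<open>An edge is a two-element set of vertices, so loops and multiple edges are excluded.\<close>

locale fin_simple_graph =
  fixes V :: "'a set" and E :: "'a set set"
  assumes finite_V: "finite V"
    and V_nonempty: "V \<noteq> {}"
    and edge_subset: "e \<in> E \<Longrightarrow> e \<subseteq> V"
    and edge_card: "e \<in> E \<Longrightarrow> card e = 2"

definition neighbors :: "'a set set \<Rightarrow> 'a \<Rightarrow> 'a set" where
  "neighbors E v = {w. {v, w} \<in> E}"

definition degree :: "'a set set \<Rightarrow> 'a \<Rightarrow> nat" where
  "degree E v = card (neighbors E v)"

text \<open>A cycle is given by the list of its distinct vertices in cyclic order; the starting vertex
  is not repeated at the end, so the length of the cycle is the length of the list.\<close>

definition is_cycle :: "'a set set \<Rightarrow> 'a list \<Rightarrow> bool" where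
  "is_cycle E xs \<longleftrightarrow> 3 \<le> length xs \<and> distinct xs \<and>
     (\<forall>i < length xs. {xs ! i, xs ! (Suc i mod length xs)} \<in> E)"

text \<open>The infimum of the empty set in \<^typ>\<open>enat\<close> is \<open>\<infinity>\<close>, the girth of an acyclic graph.\<close>

definition girth :: "'a set set \<Rightarrow> enat" where
  "girth E = (INF xs \<in> {xs. is_cycle E xs}. enat (length xs))"

definition proper_coloring :: "'a set \<Rightarrow> 'a set set \<Rightarrow> nat \<Rightarrow> ('a \<Rightarrow> nat) \<Rightarrow> bool" where
  "proper_coloring V E k c \<longleftrightarrow> c ` V = {1..k} \<and> (\<forall>x y. {x, y} \<in> E \<longrightarrow> c x \<noteq> c y)"

definition b_vertex :: "'a set set \<Rightarrow> nat \<Rightarrow> ('a \<Rightarrow> nat) \<Rightarrow> 'a \<Rightarrow> bool" where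
  "b_vertex E k c v \<longleftrightarrow> (\<forall>j \<in> {1..k}. j \<noteq> c v \<longrightarrow> (\<exists>w \<in> neighbors E v. c w = j))"

definition nice_vertex :: "'a set set \<Rightarrow> nat \<Rightarrow> ('a \<Rightarrow> nat) \<Rightarrow> 'a \<Rightarrow> bool" where
  "nice_vertex E k c u \<longleftrightarrow>
     (\<forall>j \<in> {1..k}. j \<noteq> c u \<longrightarrow> (\<exists>w \<in> neighbors E u. c w = j \<and> b_vertex E k c w))"

definition b_star_coloring :: "'a set \<Rightarrow> 'a set set \<Rightarrow> nat \<Rightarrow> ('a \<Rightarrow> nat) \<Rightarrow> bool" where
  "b_star_coloring V E k c \<longleftrightarrow> proper_coloring V E k c \<and> (\<exists>u \<in> V. nice_vertex E k c u)"

text \<open>The set below is bounded by \<^term>\<open>card V\<close>.  It is never empty: among the proper colorings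
  with the least number of colors, take one whose color class \<open>1\<close> is smallest; then every vertex
  of color \<open>1\<close> is nice.\<close>

definition b_star :: "'a set \<Rightarrow> 'a set set \<Rightarrow> nat" where
  "b_star V E = Max {k. \<exists>c. b_star_coloring V E k c}"

definition m_star :: "'a set \<Rightarrow> 'a set set \<Rightarrow> nat" where
  "m_star V E = Max {k. \<exists>v \<in> V. k \<le> degree E v \<and> k \<le> card {w \<in> neighbors E v. k \<le> degree E w}}"

lemma (in fin_simple_graph) finite_neighbors: "finite (neighbors E v)"
proof (rule finite_subset)
  show "neighbors E v \<subseteq> V"
    using edge_subset by (auto simp: neighbors_def)
qed (rule finite_V)

lemma (in fin_simple_graph) finite_b_star_set: "finite {k. \<exists>c. b_star_coloring V E k c}"
proof (rule finite_subset)
  show "{k. \<exists>c. b_star_coloring V E k c} \<subseteq> {..card V}"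
  proof
    fix k assume "k \<in> {k. \<exists>c. b_star_coloring V E k c}"
    then obtain c where "c ` V = {1..k}"
      by (auto simp: b_star_coloring_def proper_coloring_def)
    then have "k = card (c ` V)"
      by simp
    then show "k \<in> {..card V}"
      using card_image_le[OF finite_V, of c] by simp
  qed
qed simp

lemma (in fin_simple_graph) m_star_set:
  defines "M \<equiv> {k. \<exists>v \<in> V. k \<le> degree E v \<and> k \<le> card {w \<in> neighbors E v. k \<le> degree E w}}"
  shows "finite M" and "0 \<in> M"
proof -
  have "M \<subseteq> (\<Union>v \<in> V. {..degree E v})"
    by (auto simp: M_def)
  then show "finite M"
    using finite_V by (meson finite_UN_I finite_atMost finite_subset)
  show "0 \<in> M"
    using V_nonempty by (auto simp: M_def)
qed

end

theory Submission
  imports Defs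
begin

text \<open>
  The upper bound is a degree count at a nice vertex. For the lower bound let \<open>m = m_star V E\<close> and
  let \<open>H\<close> be the set of vertices of degree greater than \<open>m\<close>; by maximality of \<open>m\<close>, a vertex of
  \<open>H\<close> has at most \<open>m\<close> neighbours in \<open>H\<close>. Take a root \<open>u\<close> with \<open>m\<close> neighbours (the set \<open>W\<close>) of
  degree at least \<open>m\<close>, and \<open>m - 1\<close> further neighbours \<open>K w\<close> of each \<open>w \<in> W\<close>. The resulting tree
  \<open>T\<close> is coloured so that \<open>u\<close> is nice, and by the girth condition a vertex outside \<open>T\<close> has at most
  one neighbour in \<open>T\<close>. The colouring is extended greedily, first to \<open>H\<close> and then to the other
  vertices. This can only get stuck at a bad vertex, one in \<open>H - T\<close> with \<open>m\<close> neighbours in \<open>H\<close> and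
  a neighbour in \<open>T - H\<close>. If some vertex of \<open>H\<close> has \<open>m\<close> neighbours in \<open>H\<close>, all of which have \<open>m\<close>
  neighbours in \<open>H\<close>, then rooting the tree there allows \<open>T \<subseteq> H\<close>, and there are no bad vertices.
  Otherwise every bad vertex has a neighbour in \<open>H\<close> that is not bad, and it suffices to colour the
  bad vertices first.
\<close>

section \<open>Greedy extension of partial colourings\<close>

definition partial_coloring :: "'a set set \<Rightarrow> nat \<Rightarrow> 'a set \<Rightarrow> ('a \<Rightarrow> nat) \<Rightarrow> bool" where
  "partial_coloring E k S c \<longleftrightarrow>
     c ` S \<subseteq> {1..k} \<and> (\<forall>x \<in> S. \<forall>y \<in> S. y \<in> neighbors E x \<longrightarrow> c x \<noteq> c y)"

lemma neighbors_sym: "y \<in> neighbors E x \<longleftrightarrow> x \<in> neighbors E y"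
  by (simp add: neighbors_def insert_commute)

context fin_simple_graph
begin

lemma not_self_neighbor: "x \<notin> neighbors E x"
  using edge_card[of "{x, x}"] by (auto simp: neighbors_def)

lemma neighbors_subset: "neighbors E x \<subseteq> V"
  using edge_subset by (auto simp: neighbors_def)

text \<open>The bound counts neighbours in all of \<open>S \<union> R\<close>, so the vertices of
  \<open>R\<close> can be coloured in any order: each sees at most \<open>m\<close> of the
  \<open>m + 1\<close> colours. \<open>R\<close> may overlap \<open>S\<close>, whose colours are
  kept.\<close>

lemma greedy_extension:
  assumes "partial_coloring E (Suc m) S c" and "finite R"
    and "\<And>v. v \<in> R \<Longrightarrow> v \<notin> S \<Longrightarrow> card (neighbors E v \<inter> (S \<union> R)) \<le> m"
  shows "\<exists>c'. partial_coloring E (Suc m) (S \<union> R) c' \<and> (\<forall>x \<in> S. c' x = c x)"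
  using assms(2,1,3)
proof (induction R arbitrary: S c rule: finite_induct)
  case empty
  then show ?case by auto
next
  case (insert v R)
  show ?case
  proof (cases "v \<in> S")
    case True
    then show ?thesis
      using insert.IH[of S c] insert.prems by (simp add: insert_absorb)
  next
    case False
    have fin: "finite (neighbors E v \<inter> S)"
      using finite_neighbors by blast
    have "card (c ` (neighbors E v \<inter> S)) \<le> card (neighbors E v \<inter> S)"
      by (rule card_image_le[OF fin])
    also have "\<dots> \<le> card (neighbors E v \<inter> (S \<union> insert v R))"
      using finite_neighbors by (intro card_mono) auto
    also have "\<dots> \<le> m"
      using insert.prems(2)[of v] False by simp
    finally have "card (c ` (neighbors E v \<inter> S)) < card {1..Suc m}"
      by simp
    then have "\<not> {1..Suc m} \<subseteq> c ` (neighbors E v \<inter> S)"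
      using card_mono[OF finite_imageI[OF fin]] by (meson not_le)
    then obtain a where a: "a \<in> {1..Suc m}" "a \<notin> c ` (neighbors E v \<inter> S)"
      by blast
    define d where "d = c(v := a)"
    have "partial_coloring E (Suc m) (insert v S) d"
      unfolding partial_coloring_def
    proof (intro conjI ballI impI)
      show "d ` insert v S \<subseteq> {1..Suc m}"
        using insert.prems(1) a(1) by (auto simp: partial_coloring_def d_def)
      fix x y assume xy: "x \<in> insert v S" "y \<in> insert v S" "y \<in> neighbors E x"
      have "x \<noteq> y" using xy(3) not_self_neighbor by blast
      then consider "x = v" "y \<in> S" "y \<noteq> v" | "y = v" "x \<in> S" "x \<noteq> v"
        | "x \<in> S" "y \<in> S" "x \<noteq> v" "y \<noteq> v"
        using xy(1,2) by blast
      then show "d x \<noteq> d y"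
      proof cases
        case 1
        then show ?thesis using a(2) xy(3) by (auto simp: d_def)
      next
        case 2
        then have "x \<in> neighbors E v" using xy(3) neighbors_sym by metis
        then show ?thesis using a(2) 2 by (auto simp: d_def)
      next
        case 3
        then show ?thesis using insert.prems(1) xy(3) by (auto simp: partial_coloring_def d_def)
      qed
    qed
    moreover have "card (neighbors E x \<inter> (insert v S \<union> R)) \<le> m"
      if "x \<in> R" "x \<notin> insert v S" for x
      using insert.prems(2)[of x] that by simp
    ultimately obtain c' where "partial_coloring E (Suc m) (insert v S \<union> R) c'"
      "\<forall>x \<in> insert v S. c' x = d x"
      using insert.IH[of "insert v S" d] by blast
    then show ?thesis
      using False by (intro exI[of _ c']) (auto simp: d_def)
  qed
qed

section \<open>Upper bound: degrees around a nice vertex\<close>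

lemma b_star_coloring_degrees:
  assumes "b_star_coloring V E k c"
  shows "\<exists>v \<in> V. k - 1 \<le> degree E v \<and> k - 1 \<le> card {w \<in> neighbors E v. k - 1 \<le> degree E w}"
proof -
  obtain u where u: "u \<in> V" "nice_vertex E k c u" and im: "c ` V = {1..k}"
    using assms by (auto simp: b_star_coloring_def proper_coloring_def)
  \<comment> \<open>Applied twice: to all neighbours of a b-vertex, and to the neighbours of
    \<open>u\<close> of large degree.\<close>
  have count: "k - 1 \<le> card A"
    if "finite A" "{1..k} - {c x} \<subseteq> c ` A" "x \<in> V" for A x
  proof -
    have "c x \<in> {1..k}" using im that(3) by blast
    then have "k - 1 = card ({1..k} - {c x})" by simp
    also have "\<dots> \<le> card (c ` A)" using that by (intro card_mono) auto
    also have "\<dots> \<le> card A" using that(1) by (rule card_image_le)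
    finally show ?thesis .
  qed
  have b: "k - 1 \<le> degree E w" if "w \<in> V" "b_vertex E k c w" for w
    unfolding degree_def using that
    by (intro count[of _ w]) (auto simp: finite_neighbors b_vertex_def)
  have "k - 1 \<le> card {w \<in> neighbors E u. k - 1 \<le> degree E w}"
  proof (rule count[of _ u])
    show "{1..k} - {c u} \<subseteq> c ` {w \<in> neighbors E u. k - 1 \<le> degree E w}"
    proof
      fix j assume "j \<in> {1..k} - {c u}"
      then obtain w where "w \<in> neighbors E u" "c w = j" "b_vertex E k c w"
        using u(2) by (auto simp: nice_vertex_def)
      then show "j \<in> c ` {w \<in> neighbors E u. k - 1 \<le> degree E w}"
        using b neighbors_subset by blast
    qed
  qed (use u finite_neighbors in auto)
  moreover have "\<dots> \<le> degree E u"
    unfolding degree_def by (intro card_mono) (auto simp: finite_neighbors)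
  ultimately show ?thesis using u(1) by (meson order_trans)
qed

end

section \<open>Exclusion of short cycles\<close>

locale girth_seven_graph = fin_simple_graph +
  assumes girth: "7 \<le> girth E"
begin

lemma cycle_length:
  assumes "is_cycle E xs"
  shows "7 \<le> length xs"
proof -
  have "Defs.girth E \<le> enat (length xs)"
    unfolding girth_def using assms by (intro INF_lower) simp
  then have "7 \<le> enat (length xs)"
    using girth by (rule order_trans[rotated])
  then show ?thesis
    by (simp add: numeral_eq_enat)
qed

lemma no_triangle:
  assumes "b \<in> neighbors E a" "c \<in> neighbors E b" "a \<in> neighbors E c"
  shows False
proof -
  have "distinct [a, b, c]"
    using assms not_self_neighbor by auto
  then have "is_cycle E [a, b, c]"
    using assms by (auto simp: is_cycle_def neighbors_def less_Suc_eq)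
  from cycle_length[OF this] show False by simp
qed

text \<open>Consecutive vertices differ since there are no loops, so only the two diagonals are
  assumed distinct.\<close>

lemma no_four_cycle:
  assumes "b \<in> neighbors E a" "c \<in> neighbors E b" "d \<in> neighbors E c" "a \<in> neighbors E d"
    and "a \<noteq> c" "b \<noteq> d"
  shows False
proof -
  have "distinct [a, b, c, d]"
    using assms not_self_neighbor by auto
  then have "is_cycle E [a, b, c, d]"
    using assms by (auto simp: is_cycle_def neighbors_def less_Suc_eq)
  from cycle_length[OF this] show False by simp
qed

text \<open>A degenerate closed walk of length 5 contains a triangle, so distinctness is automatic.\<close>

lemma no_closed_five_walk:
  assumes "b \<in> neighbors E a" "c \<in> neighbors E b" "d \<in> neighbors E c" "e \<in> neighbors E d"
    "a \<in> neighbors E e"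
  shows False
proof -
  have "a \<noteq> c" "a \<noteq> d" "b \<noteq> d" "b \<noteq> e" "c \<noteq> e"
    using no_triangle[of d c e] no_triangle[of b a c] no_triangle[of e d a] no_triangle[of c b d]
      assms by auto
  then have "distinct [a, b, c, d, e]"
    using assms not_self_neighbor by auto
  then have "is_cycle E [a, b, c, d, e]"
    using assms by (auto simp: is_cycle_def neighbors_def less_Suc_eq)
  from cycle_length[OF this] show False by simp
qed

text \<open>Vertices two steps apart are assumed distinct; equal opposite vertices would close a
  triangle.\<close>

lemma no_six_cycle:
  assumes "b \<in> neighbors E a" "c \<in> neighbors E b" "d \<in> neighbors E c" "e \<in> neighbors E d"
    "f \<in> neighbors E e" "a \<in> neighbors E f"
    and "a \<noteq> c" "b \<noteq> d" "c \<noteq> e" "d \<noteq> f" "e \<noteq> a" "f \<noteq> b"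
  shows False
proof -
  have "a \<noteq> d" "b \<noteq> e" "c \<noteq> f"
    using no_triangle[of b a c] no_triangle[of c b d] no_triangle[of d c e] assms by auto
  then have "distinct [a, b, c, d, e, f]"
    using assms not_self_neighbor by auto
  then have "is_cycle E [a, b, c, d, e, f]"
    using assms by (auto simp: is_cycle_def neighbors_def less_Suc_eq)
  from cycle_length[OF this] show False by simp
qed

end

section \<open>The tree and its position in the graph\<close>

text \<open>The sizes are exact so that colours can be assigned by bijections: \<open>w\<close> sees
  one colour at \<open>u\<close> and \<open>m - 1\<close> others on \<open>K w\<close>. The
  subtraction is genuine, as \<open>w \<in> W\<close> forces \<open>m > 0\<close>. Disjointness of
  the layers follows from the girth.\<close>

locale rooted_tree = girth_seven_graph +
  fixes m :: nat and u :: 'a and W :: "'a set" and K :: "'a \<Rightarrow> 'a set"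
  assumes u_in_V: "u \<in> V"
    and W_neighbors: "W \<subseteq> neighbors E u"
    and card_W: "card W = m"
    and K_neighbors: "w \<in> W \<Longrightarrow> K w \<subseteq> neighbors E w - {u}"
    and card_K: "w \<in> W \<Longrightarrow> card (K w) = m - 1"
begin

definition T :: "'a set" where
  "T = insert u (W \<union> (\<Union>w \<in> W. K w))"

lemma T_cases:
  assumes "x \<in> T"
  obtains "x = u" | "x \<in> W" | w where "w \<in> W" "x \<in> K w"
  using assms by (auto simp: T_def)

lemma T_subset_V: "T \<subseteq> V"
  using u_in_V W_neighbors K_neighbors neighbors_subset unfolding T_def by blast

lemma root_adjacent: "w \<in> W \<Longrightarrow> w \<in> neighbors E u" "w \<in> W \<Longrightarrow> u \<in> neighbors E w"
  using W_neighbors neighbors_sym[of u E w] by auto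

lemma leaf_adjacent:
  assumes "w \<in> W" "x \<in> K w"
  shows "x \<in> neighbors E w" "w \<in> neighbors E x" "x \<noteq> u"
  using assms K_neighbors neighbors_sym[of x E w] by auto

text \<open>A second vertex of \<open>W\<close> adjacent to \<open>x\<close> would give the 4-cycle
  \<open>w\<close>, \<open>u\<close>, \<open>w'\<close>, \<open>x\<close>.\<close>

lemma leaf_parent_unique:
  assumes "w \<in> W" "x \<in> K w" "w' \<in> W" "x \<in> neighbors E w'"
  shows "w' = w"
proof -
  have "w' \<in> neighbors E x" using assms(4) neighbors_sym by metis
  then show ?thesis
    using no_four_cycle[of w u x w'] root_adjacent(1)[OF assms(1)] root_adjacent(2)[OF assms(3)]
      leaf_adjacent[OF assms(1,2)] by blast
qed

lemma leaf_not_root_neighbor: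
  assumes "w \<in> W" "x \<in> K w"
  shows "x \<notin> neighbors E u"
proof
  assume "x \<in> neighbors E u"
  then show False
    using no_triangle[of x u w] root_adjacent(2)[OF assms(1)] leaf_adjacent(2)[OF assms] by blast
qed

lemma leaf_notin_W:
  assumes "w \<in> W" "x \<in> K w"
  shows "x \<notin> W"
  using leaf_not_root_neighbor[OF assms] W_neighbors by blast

text \<open>Together with the next two lemmas this says that \<open>T\<close> is an induced
  subgraph: any edge inside \<open>T\<close> other than a tree edge would close a cycle of length at
  most 5.\<close>

lemma root_neighbor_in_T:
  assumes "x \<in> T" "x \<in> neighbors E u"
  shows "x \<in> W"
  using assms(1)
proof (cases rule: T_cases)
  case (3 w)
  then show ?thesis using leaf_not_root_neighbor assms(2) by blast
qed (use assms not_self_neighbor in auto)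

lemma W_neighbor_in_T:
  assumes "w \<in> W" "x \<in> T" "x \<in> neighbors E w"
  shows "x = u \<or> x \<in> K w"
  using assms(2)
proof (cases rule: T_cases)
  case 2
  then show ?thesis
    using no_triangle[of w u x] root_adjacent(1)[OF assms(1)] root_adjacent(2)[OF 2] assms(3)
    by blast
next
  case (3 w')
  then show ?thesis using leaf_parent_unique[OF 3 assms(1,3)] by simp
qed simp

lemma leaf_neighbor_in_T:
  assumes "w \<in> W" "x \<in> K w" "y \<in> T" "y \<in> neighbors E x"
  shows "y = w"
proof -
  have x: "x \<in> neighbors E y" using assms(4) neighbors_sym by metis
  from assms(3) show ?thesis
  proof (cases rule: T_cases)
    case 1
    then show ?thesis using leaf_not_root_neighbor[OF assms(1,2)] x by simp
  next
    case 2
    then show ?thesis using leaf_parent_unique[OF assms(1,2) 2 x] by simp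
  next
    case (3 w')
    then show ?thesis
      using no_closed_five_walk[of x w y w' u] root_adjacent(1)[OF assms(1)]
        root_adjacent(2)[OF 3(1)] leaf_adjacent(1)[OF assms(1,2)] leaf_adjacent(2)[OF 3] assms(4)
      by blast
  qed
qed

text \<open>Two vertices of \<open>T\<close> are joined by a tree path of length at most 4, so a
  second neighbour of \<open>v\<close> in \<open>T\<close> would close a cycle of length at most
  6.\<close>

lemma two_neighbors_in_T:
  assumes v: "v \<notin> T" and x: "x \<in> T" "v \<in> neighbors E x" and y: "y \<in> T" "v \<in> neighbors E y"
  shows "x = y"
proof -
  have v_ne: "v \<noteq> w" if "w \<in> W" for w
    using v that by (auto simp: T_def)
  have root: "z = u" if z: "z \<in> T" "v \<in> neighbors E z" and u: "u \<in> neighbors E v" for z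
    using z(1)
  proof (cases rule: T_cases)
    case 2
    then show ?thesis
      using no_triangle[of z u v] root_adjacent(1) z(2) u by blast
  next
    case (3 w)
    then show ?thesis
      using no_four_cycle[of w u z v] root_adjacent(1)[of w] leaf_adjacent[OF 3] z(2) u v_ne[of w]
      by blast
  qed simp
  have leaf: False
    if z: "w \<in> W" "z \<in> K w" "z \<in> neighbors E v" and w': "w' \<in> W" "v \<in> neighbors E w'" for w z w'
  proof (cases "w' = w")
    case True
    then show ?thesis
      using no_triangle[of z v w] leaf_adjacent[OF z(1,2)] z(3) w'(2) by blast
  next
    case False
    then show ?thesis
      using no_closed_five_walk[of z v w u w'] leaf_adjacent[OF z(1,2)] z(3) w'
        root_adjacent(1)[OF w'(1)] root_adjacent(2)[OF z(1)] by blast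
  qed
  have x': "x \<in> neighbors E v" and y': "y \<in> neighbors E v"
    using x(2) y(2) neighbors_sym by metis+
  from x(1) show ?thesis
  proof (cases rule: T_cases)
    case 1
    then show ?thesis using root[OF y] x' by simp
  next
    case 2
    note xW = this
    from y(1) show ?thesis
    proof (cases rule: T_cases)
      case 1
      then show ?thesis using root[OF x] y' by simp
    next
      case 2
      have "u \<noteq> v" using v by (auto simp: T_def)
      then show ?thesis
        using no_four_cycle[of x u v y] root_adjacent(1)[OF xW] root_adjacent(2)[OF 2] x(2) y'
        by blast
    next
      case (3 w)
      then show ?thesis using leaf[OF 3 y' xW x(2)] by simp
    qed
  next
    case (3 w)
    note xK = this
    from y(1) show ?thesis
    proof (cases rule: T_cases)
      case 1
      then show ?thesis using root[OF x] y' by simp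
    next
      case 2
      then show ?thesis using leaf[OF xK x' 2 y(2)] by simp
    next
      case (3 w')
      show ?thesis
      proof (cases "w = w'")
        case True
        then show ?thesis
          using no_four_cycle[of x v w y] leaf_adjacent(2)[OF xK] leaf_adjacent(1)[OF 3] x' y(2)
            v_ne[OF xK(1)] by blast
      next
        case False
        \<comment> \<open>Leaves with different parents are the extreme case, the 6-cycle
          \<open>v\<close>, \<open>x\<close>, \<open>w\<close>, \<open>u\<close>, \<open>w'\<close>,
          \<open>y\<close>.\<close>
        then show ?thesis
          using no_six_cycle[of x v w u w' y] leaf_adjacent(2,3)[OF xK] leaf_adjacent(1,3)[OF 3]
            root_adjacent(2)[OF xK(1)] root_adjacent(1)[OF 3(1)] x' y(2) v_ne[OF xK(1)] v_ne[OF 3(1)]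
          by blast
      qed
    qed
  qed
qed

lemma card_neighbors_in_T:
  assumes "v \<notin> T"
  shows "card (neighbors E v \<inter> T) \<le> 1"
  using two_neighbors_in_T[OF assms] neighbors_sym[of v E] finite_neighbors
  by (auto simp: card_le_Suc0_iff_eq)

section \<open>Colouring the tree so that the root is nice\<close>

lemma tree_coloring:
  obtains c where "partial_coloring E (Suc m) T c"
    and "c u = Suc m" and "c ` W = {1..m}"
    and "\<And>w. w \<in> W \<Longrightarrow> c ` K w = {1..m} - {c w}"
proof -
  have "finite W"
    using W_neighbors finite_neighbors finite_subset by blast
  then obtain f where f: "bij_betw f W {1..m}"
    using card_W finite_same_card_bij[of W "{1..m}"] by auto
  have "\<exists>h. bij_betw h (K w) ({1..m} - {f w})" if "w \<in> W" for w
  proof (rule finite_same_card_bij)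
    show "finite (K w)"
      using K_neighbors[OF that] finite_neighbors by (meson finite_Diff finite_subset)
    have "f w \<in> {1..m}" using f that by (auto simp: bij_betw_def)
    then show "card (K w) = card ({1..m} - {f w})"
      using card_K[OF that] by simp
  qed simp
  then obtain g where g: "\<And>w. w \<in> W \<Longrightarrow> bij_betw (g w) (K w) ({1..m} - {f w})"
    by metis
  \<comment> \<open>The parent of a leaf, unique by \<open>leaf_parent_unique\<close>; so the
    bijections \<open>g w\<close> combine into one colouring.\<close>
  define p where "p x = (SOME w. w \<in> W \<and> x \<in> K w)" for x
  have p: "p x = w" if "w \<in> W" "x \<in> K w" for w x
    unfolding p_def using that leaf_parent_unique leaf_adjacent by (intro some_equality) blast+
  define c where "c x = (if x = u then Suc m else if x \<in> W then f x else g (p x) x)" for x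
  have u_W: "u \<notin> W" using W_neighbors not_self_neighbor by blast
  have cu: "c u = Suc m" by (simp add: c_def)
  have cw: "c w = f w" if "w \<in> W" for w using that u_W by (auto simp: c_def)
  have ck: "c x = g w x" if "w \<in> W" "x \<in> K w" for w x
    using that p leaf_notin_W leaf_adjacent by (auto simp: c_def)
  have W: "c ` W = {1..m}"
    using f cw by (simp add: bij_betw_def)
  have K: "c ` K w = {1..m} - {c w}" if "w \<in> W" for w
    using g[OF that] ck[OF that] cw[OF that] by (simp add: bij_betw_def)
  have "partial_coloring E (Suc m) T c"
    unfolding partial_coloring_def
  proof (intro conjI ballI impI)
    have "c ` K w \<subseteq> {1..Suc m}" if "w \<in> W" for w
      using K[OF that] by auto
    moreover have "c ` W \<subseteq> {1..Suc m}" using W by auto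
    ultimately show "c ` T \<subseteq> {1..Suc m}"
      using cu by (auto simp: T_def)
    have uw: "c w \<noteq> c u" if "w \<in> W" for w
    proof -
      have "c w \<in> {1..m}" using W that by blast
      then show ?thesis using cu by simp
    qed
    have wk: "c x \<noteq> c w" if "w \<in> W" "x \<in> K w" for w x
      using K[OF that(1)] that(2) by blast
    fix x y assume x: "x \<in> T" and y: "y \<in> T" "y \<in> neighbors E x"
    from x show "c x \<noteq> c y"
    proof (cases rule: T_cases)
      case 1
      then show ?thesis using root_neighbor_in_T y uw by metis
    next
      case 2
      then show ?thesis using W_neighbor_in_T[OF 2 y] uw wk by metis
    next
      case (3 w)
      then show ?thesis using leaf_neighbor_in_T[OF 3 y] wk by metis
    qed
  qed
  then show thesis using that cu W K by blast
qed

lemma nice_root: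
  assumes c: "c u = Suc m" "c ` W = {1..m}" "\<And>w. w \<in> W \<Longrightarrow> c ` K w = {1..m} - {c w}"
  shows "nice_vertex E (Suc m) c u"
proof -
  have "b_vertex E (Suc m) c w" if w: "w \<in> W" for w
    unfolding b_vertex_def
  proof (intro ballI impI)
    fix j assume j: "j \<in> {1..Suc m}" "j \<noteq> c w"
    show "\<exists>x \<in> neighbors E w. c x = j"
    proof (cases "j = Suc m")
      case True
      then show ?thesis using c(1) root_adjacent(2)[OF w] by blast
    next
      case False
      then have "j \<in> c ` K w" using c(3)[OF w] j by auto
      then show ?thesis using K_neighbors[OF w] by blast
    qed
  qed
  moreover have "\<exists>w \<in> W. c w = j" if "j \<in> {1..Suc m}" "j \<noteq> c u" for j
  proof -
    have "j \<in> c ` W" using c(1,2) that by auto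
    then show ?thesis by blast
  qed
  ultimately show ?thesis
    unfolding nice_vertex_def using W_neighbors by blast
qed

section \<open>Extending the tree colouring to the whole graph\<close>

text \<open>Each stage of the order \<open>T\<close>, \<open>B\<close>, \<open>H\<close>,
  \<open>V\<close> keeps earlier colours, so the root stays nice.\<close>

lemma b_star_coloring_exists:
  fixes H :: "'a set"
  assumes H: "H = {v \<in> V. m < degree E v}"
    and le: "\<And>v. v \<in> H \<Longrightarrow> card (neighbors E v \<inter> H) \<le> m"
    and T: "T \<subseteq> H \<or> (\<forall>v \<in> H. card (neighbors E v \<inter> H) = m \<longrightarrow>
               (\<exists>w \<in> neighbors E v \<inter> H. card (neighbors E w \<inter> H) < m))"
  shows "\<exists>c. b_star_coloring V E (Suc m) c"
proof -
  \<comment> \<open>A vertex of \<open>H - T\<close> has at most \<open>m\<close> neighbours in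
    \<open>H\<close> and at most one in \<open>T\<close>. The total exceeds \<open>m\<close> only if
    there are \<open>m\<close> in \<open>H\<close> and the one in \<open>T\<close> lies outside
    \<open>H\<close>; \<open>B\<close> collects these bad vertices.\<close>
  define B where "B = {v \<in> H - T. card (neighbors E v \<inter> H) = m \<and> \<not> neighbors E v \<inter> T \<subseteq> H}"
  have fin: "finite B" "finite H" "finite V"
    using finite_V by (auto simp: B_def H)
  have finN: "finite (neighbors E v \<inter> X)" for v X
    using finite_neighbors by blast
  obtain c0 where c0: "partial_coloring E (Suc m) T c0"
    and "c0 u = Suc m" "c0 ` W = {1..m}" "\<And>w. w \<in> W \<Longrightarrow> c0 ` K w = {1..m} - {c0 w}"
    by (rule tree_coloring) blast
  note c0_nice = this(2-4)
  have "card (neighbors E v \<inter> (T \<union> B)) \<le> m" if v: "v \<in> B" for v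
  proof -
    have "\<not> T \<subseteq> H" "v \<in> H" "v \<notin> T" "card (neighbors E v \<inter> H) = m"
      using v by (auto simp: B_def)
    with T obtain w where w: "w \<in> neighbors E v \<inter> H" "card (neighbors E w \<inter> H) < m"
      by blast
    then have "w \<notin> B" by (simp add: B_def)
    \<comment> \<open>Since \<open>B\<close> lies in \<open>H\<close> and \<open>w\<close> is not in
      \<open>B\<close>, at most \<open>m - 1\<close> neighbours of \<open>v\<close> are in
      \<open>B\<close>, leaving room for the one in \<open>T\<close>.\<close>
    then have "neighbors E v \<inter> (T \<union> B) \<subseteq> (neighbors E v \<inter> T) \<union> (neighbors E v \<inter> H - {w})"
      by (auto simp: B_def)
    then have "card (neighbors E v \<inter> (T \<union> B))
        \<le> card ((neighbors E v \<inter> T) \<union> (neighbors E v \<inter> H - {w}))"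
      using finN by (intro card_mono) auto
    also have "\<dots> \<le> card (neighbors E v \<inter> T) + card (neighbors E v \<inter> H - {w})"
      by (rule card_Un_le)
    also have "\<dots> \<le> 1 + (m - 1)"
      using card_neighbors_in_T[OF \<open>v \<notin> T\<close>] w(1) \<open>card (neighbors E v \<inter> H) = m\<close>
      by (intro add_mono) auto
    also have "\<dots> = m" using w(2) by simp
    finally show ?thesis .
  qed
  then obtain c1 where c1: "partial_coloring E (Suc m) (T \<union> B) c1" "\<forall>x \<in> T. c1 x = c0 x"
    using greedy_extension[OF c0 fin(1)] by blast
  \<comment> \<open>Not being bad, \<open>v\<close> either has its neighbours in \<open>T\<close>
    already counted in \<open>H\<close>, or has fewer than \<open>m\<close> in \<open>H\<close> and
    room for one more.\<close>
  have "card (neighbors E v \<inter> (T \<union> B \<union> H)) \<le> m" if v: "v \<in> H" "v \<notin> T \<union> B" for v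
  proof -
    have eq: "neighbors E v \<inter> (T \<union> B \<union> H) = (neighbors E v \<inter> T) \<union> (neighbors E v \<inter> H)"
      by (auto simp: B_def)
    show ?thesis
    proof (cases "neighbors E v \<inter> T \<subseteq> H")
      case True
      then have "neighbors E v \<inter> (T \<union> B \<union> H) = neighbors E v \<inter> H"
        using eq by blast
      then show ?thesis using le[OF v(1)] by simp
    next
      case False
      then have "card (neighbors E v \<inter> H) < m"
        using v le[OF v(1)] by (auto simp: B_def)
      moreover have "card (neighbors E v \<inter> T) \<le> 1"
        using v by (intro card_neighbors_in_T) simp
      moreover have "card (neighbors E v \<inter> (T \<union> B \<union> H))
          \<le> card (neighbors E v \<inter> T) + card (neighbors E v \<inter> H)"
        unfolding eq by (rule card_Un_le)
      ultimately show ?thesis by linarith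
    qed
  qed
  then obtain c2 where c2: "partial_coloring E (Suc m) (T \<union> B \<union> H) c2"
    "\<forall>x \<in> T \<union> B. c2 x = c1 x"
    using greedy_extension[OF c1(1) fin(2)] by blast
  have "card (neighbors E v \<inter> (T \<union> B \<union> H \<union> V)) \<le> m" if "v \<in> V" "v \<notin> T \<union> B \<union> H" for v
  proof -
    have "card (neighbors E v \<inter> (T \<union> B \<union> H \<union> V)) \<le> degree E v"
      unfolding degree_def by (intro card_mono) (auto simp: finite_neighbors)
    then show ?thesis using that by (auto simp: H)
  qed
  then obtain c where c: "partial_coloring E (Suc m) (T \<union> B \<union> H \<union> V) c"
    "\<forall>x \<in> T \<union> B \<union> H. c x = c2 x"
    using greedy_extension[OF c2(1) fin(3)] by blast
  have all: "T \<union> B \<union> H \<union> V = V"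
    using T_subset_V by (auto simp: B_def H)
  have agree: "c x = c0 x" if "x \<in> T" for x
    using that c(2) c2(2) c1(2) by simp
  have agree_u: "c u = Suc m"
    using agree[of u] c0_nice(1) by (simp add: T_def)
  have "c ` W = c0 ` W"
    using agree by (intro image_cong) (auto simp: T_def)
  then have agree_W: "c ` W = {1..m}"
    using c0_nice(2) by simp
  have agree_K: "c ` K w = {1..m} - {c w}" if w: "w \<in> W" for w
  proof -
    have "c ` K w = c0 ` K w"
      using w agree by (intro image_cong) (auto simp: T_def)
    moreover have "c w = c0 w" using w agree by (simp add: T_def)
    ultimately show ?thesis using c0_nice(3)[OF w] by simp
  qed
  \<comment> \<open>Surjectivity: the root and \<open>W\<close> already use every colour.\<close>
  have "{1..Suc m} = c ` insert u W"
    using agree_u agree_W by (simp add: atLeastAtMostSuc_conv)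
  then have "{1..Suc m} \<subseteq> c ` V"
    using T_subset_V by (auto simp: T_def)
  moreover have "c ` V \<subseteq> {1..Suc m}"
    using c(1) unfolding all partial_coloring_def by blast
  moreover have "c x \<noteq> c y" if "{x, y} \<in> E" for x y
    using c(1) edge_subset[OF that] that unfolding all partial_coloring_def neighbors_def by blast
  ultimately have "proper_coloring V E (Suc m) c"
    by (auto simp: proper_coloring_def)
  then show ?thesis
    using nice_root[OF agree_u agree_W agree_K] u_in_V by (auto simp: b_star_coloring_def)
qed

end

section \<open>Choosing the root, and conclusion\<close>

context girth_seven_graph
begin

lemma b_star_coloring_m_star: "\<exists>c. b_star_coloring V E (Suc (m_star V E)) c"
proof -
  define M where
    "M = {k. \<exists>v \<in> V. k \<le> degree E v \<and> k \<le> card {w \<in> neighbors E v. k \<le> degree E w}}"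
  define m where "m = m_star V E"
  have M: "finite M" "M \<noteq> {}" "m = Max M"
    using m_star_set by (auto simp: M_def m_def m_star_def)
  define H where "H = {v \<in> V. m < degree E v}"
  have le: "card (neighbors E v \<inter> H) \<le> m" if "v \<in> H" for v
  proof (rule ccontr)
    assume "\<not> ?thesis"
    moreover have "neighbors E v \<inter> H = {w \<in> neighbors E v. Suc m \<le> degree E w}"
      using neighbors_subset by (auto simp: H_def)
    ultimately have "Suc m \<le> card {w \<in> neighbors E v. Suc m \<le> degree E w}"
      by simp
    then have "Suc m \<in> M"
      using that by (auto simp: M_def H_def intro!: bexI[of _ v])
    then show False using M(3) Max_ge[OF M(1), of "Suc m"] by simp
  qed
  \<comment> \<open>\<open>Q\<close> confines the tree: it will be \<open>H\<close> when a tree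
    inside \<open>H\<close> is wanted, and \<open>UNIV\<close> otherwise.\<close>
  have tree: "\<exists>W K. rooted_tree V E m u W K \<and> W \<subseteq> neighbors E u \<inter> Q \<and> (\<forall>w \<in> W. K w \<subseteq> Q)"
    if u: "u \<in> V" and card: "m \<le> card {w \<in> neighbors E u \<inter> Q. m \<le> card (neighbors E w \<inter> Q)}"
      and Q: "u \<in> Q" for u Q
  proof -
    obtain W where W: "W \<subseteq> {w \<in> neighbors E u \<inter> Q. m \<le> card (neighbors E w \<inter> Q)}" "card W = m"
      using obtain_subset_with_card_n[OF card] by metis
    have "\<exists>K. K \<subseteq> neighbors E w \<inter> Q - {u} \<and> card K = m - 1" if "w \<in> W" for w
    proof -
      have "u \<in> neighbors E w \<inter> Q" and "m \<le> card (neighbors E w \<inter> Q)"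
        using that W(1) Q neighbors_sym[of w E u] by auto
      then have "m - 1 \<le> card (neighbors E w \<inter> Q - {u})"
        by simp
      then show ?thesis
        by (meson obtain_subset_with_card_n)
    qed
    then obtain K where K: "\<And>w. w \<in> W \<Longrightarrow> K w \<subseteq> neighbors E w \<inter> Q - {u} \<and> card (K w) = m - 1"
      by metis
    have "rooted_tree V E m u W K"
      using u W K by unfold_locales blast+
    then show ?thesis using W(1) K by blast
  qed
  have "\<exists>c. b_star_coloring V E (Suc m) c"
  proof (cases "\<exists>u \<in> H. card (neighbors E u \<inter> H) = m \<and>
      (\<forall>w \<in> neighbors E u \<inter> H. m \<le> card (neighbors E w \<inter> H))")
    case True
    then obtain u where u: "u \<in> H" "card (neighbors E u \<inter> H) = m"
      and "\<forall>w \<in> neighbors E u \<inter> H. m \<le> card (neighbors E w \<inter> H)"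
      by blast
    then have "{w \<in> neighbors E u \<inter> H. m \<le> card (neighbors E w \<inter> H)} = neighbors E u \<inter> H"
      by blast
    then obtain W K where WK: "rooted_tree V E m u W K" "W \<subseteq> neighbors E u \<inter> H"
      "\<forall>w \<in> W. K w \<subseteq> H"
      using tree[of u H] u by (auto simp: H_def)
    interpret rooted_tree V E m u W K by (rule WK(1))
    have "T \<subseteq> H"
      using WK u(1) by (auto simp: T_def)
    then show ?thesis
      using b_star_coloring_exists[OF H_def le] by blast
  next
    case False
    have "m \<in> M" using M Max_in by blast
    then obtain u where u: "u \<in> V" "m \<le> card {w \<in> neighbors E u. m \<le> degree E w}"
      by (auto simp: M_def)
    then obtain W K where WK: "rooted_tree V E m u W K"
      using tree[of u UNIV] by (auto simp: degree_def)
    interpret rooted_tree V E m u W K by (rule WK)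
    \<comment> \<open>The negated case condition is exactly the second alternative on
      \<open>T\<close> in \<open>b_star_coloring_exists\<close>.\<close>
    show ?thesis
      using b_star_coloring_exists[OF H_def le] False by (meson not_le)
  qed
  then show ?thesis by (simp add: m_def)
qed

end

theorem theorem1:
  fixes V :: "'a set" and E :: "'a set set"
  assumes "fin_simple_graph V E"
    and "7 \<le> girth E"
  shows "b_star V E = m_star V E + 1"
proof -
  interpret girth_seven_graph V E
    using assms by (simp add: girth_seven_graph_def girth_seven_graph_axioms_def)
  show ?thesis
    unfolding b_star_def
  proof (rule Max_eqI[OF finite_b_star_set])
    show "m_star V E + 1 \<in> {k. \<exists>c. b_star_coloring V E k c}"
      using b_star_coloring_m_star by simp
    fix k assume "k \<in> {k. \<exists>c. b_star_coloring V E k c}"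
    then have "k - 1 \<le> m_star V E"
      unfolding m_star_def using b_star_coloring_degrees by (intro Max_ge m_star_set) blast
    then show "k \<le> m_star V E + 1" by simp
  qed
qed

end
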